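(* Let $d\in\mathbb{N}$ and let $\mathcal{F}$ be a family of compact connected subsets of $\mathbb{R}^d$. Suppose that every infinite subfamily of $\mathcal{F}$ contains $d+1$ distinct sets that are all pierced by a single hyperplane (i.e. there is one affine hyperplane intersecting each of these $d+1$ sets). Then $\mathcal{F}$ has a finite hyperplane transversal, i.e. there is a finite set $\mathcal{H}$ of affine hyperplanes in $\mathbb{R}^d$ such that every set in $\mathcal{F}$ intersects at least one hyperplane in $\mathcal{H}$.
   Context: A hyperplane in $\mathbb{R}^d$ is an affine subspace of dimension $d-1$ (for $d=1$ these are points). A hyperplane pierces a set if it has nonempty intersection with it. *)

theory Defs
  imports "HOL-Analysis.Analysis"
begin

(* Index types are nonempty, so the dimension CARD('d) is at least 1 and a hyperplane is
   never empty; for dimension 1 the hyperplanes are the points. *)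
definition affine_hyperplane :: "(real ^ 'd) set \<Rightarrow> bool" where
  "affine_hyperplane H \<longleftrightarrow> affine H \<and> aff_dim H = int CARD('d) - 1"

definition pierces :: "(real ^ 'd) set \<Rightarrow> (real ^ 'd) set \<Rightarrow> bool" where
  "pierces H S \<longleftrightarrow> H \<inter> S \<noteq> {}"

definition finite_hyperplane_transversal :: "(real ^ 'd) set set \<Rightarrow> bool" where
  "finite_hyperplane_transversal F \<longleftrightarrow>
     (\<exists>\<H>. finite \<H> \<and> (\<forall>H\<in>\<H>. affine_hyperplane H) \<and> (\<forall>S\<in>F. \<exists>H\<in>\<H>. pierces H S))"

end

theory Submission
  imports Defs
begin

text \<open>
  Put each set at height 1 in one dimension more, so that a hyperplane becomes a nonzero linear
  functional having a zero on the set. If no finite set of functionals suffices, there is a proper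
  filter on the family along which every fixed functional eventually has no zero, hence, by
  connectedness, constant sign. By compactness of the unit sphere the filter can be refined so that
  the sets concentrate in a direction \<open>v\<close>; repeating this in the orthogonal complement of \<open>v\<close> yields a
  full flag \<open>V 0 \<subset> V 1 \<subset> \<dots>\<close> such that each compact set of functionals in
  \<open>V (Suc i) - V i\<close> is eventually disjoint from the functionals with a zero. This allows one to
  choose infinitely many members such that no \<open>k\<close> of them share a nonzero functional from \<open>V k\<close>;
  for the top dimension this contradicts the hypothesis.
\<close>

section \<open>Functionals with a zero on a set\<close>

definition hits :: "'a::real_inner \<Rightarrow> 'a set \<Rightarrow> bool" where
  "hits L S \<longleftrightarrow> (\<exists>x\<in>S. L \<bullet> x = 0)"

lemma hits_scaleR_iff: "c \<noteq> 0 \<Longrightarrow> hits (c *\<^sub>R L) S \<longleftrightarrow> hits L S"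
  by (simp add: hits_def)

lemma connected_not_hits_pos:
  assumes "connected S" "\<not> hits L S" "x \<in> S" "L \<bullet> x > 0" "y \<in> S"
  shows "L \<bullet> y > 0"
  using connected_ivt_hyperplane[of S y x L 0] assms
  by (force simp: hits_def)

text \<open>The incidence relation between points and functionals is closed, and projecting it along
  the compact factor \<open>S\<close> preserves closedness. This is how compactness of the members
  enters.\<close>

lemma closed_hits:
  fixes S :: "'a::euclidean_space set"
  assumes "compact S"
  shows "closed {L. hits L S}"
proof -
  have "closed {(x, L :: 'a). L \<bullet> x = 0}"
    unfolding case_prod_beta by (intro closed_Collect_eq continuous_intros)
  from closed_compact_projection[OF assms this] show ?thesis
    by (simp add: hits_def Bex_def)
qed

lemma obtain_orthonormal_basis:
  fixes W :: "'a::euclidean_space set"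
  assumes "subspace W"
  obtains B where "finite B" "B \<subseteq> W" "\<And>L. L \<in> W \<Longrightarrow> (\<Sum>b\<in>B. (L \<bullet> b) *\<^sub>R b) = L"
    "\<And>b. b \<in> B \<Longrightarrow> norm b = 1"
proof -
  obtain B where B: "B \<subseteq> W" "pairwise orthogonal B" "\<And>x. x \<in> B \<Longrightarrow> norm x = 1"
    "independent B" "span B = W"
    using orthonormal_basis_subspace[OF assms] by metis
  have "finite B" using B(4) independent_bound by blast
  show thesis
    by (rule that[of B]) (use B \<open>finite B\<close> orthonormal_basis_expand[of B] in auto)
qed

section \<open>Concentration in one direction along a filter\<close>

text \<open>Pick a point in each set, project it to \<open>W\<close> and normalise: by compactness
  of the unit sphere of \<open>W\<close> these directions have a cluster point \<open>v\<close>, and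
  a finer filter makes them converge to it. If \<open>L \<bullet> v > 0\<close>, then
  \<open>L\<close> is eventually positive at the chosen point, hence on the whole connected set,
  where it eventually has no zero.\<close>

lemma cluster_direction:
  fixes E :: "'a::euclidean_space set filter"
  assumes E: "E \<noteq> bot" and W: "subspace W" and W0: "W \<noteq> {0}"
    and conn: "eventually (\<lambda>S. S \<noteq> {} \<and> connected S) E"
    and miss: "\<forall>L\<in>W. L \<noteq> 0 \<longrightarrow> eventually (\<lambda>S. \<not> hits L S) E"
  obtains E' v where "E' \<le> E" "E' \<noteq> bot" "v \<in> W" "norm v = 1"
    "\<forall>L\<in>W. L \<bullet> v > 0 \<longrightarrow> eventually (\<lambda>S. \<forall>x\<in>S. L \<bullet> x > 0) E'"
proof -
  have "\<exists>p\<in>W. \<forall>L\<in>W. L \<bullet> x = L \<bullet> p" for x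
  proof -
    obtain p q where pq: "p \<in> span W" "\<And>w. w \<in> span W \<Longrightarrow> orthogonal q w" "x = p + q"
      using orthogonal_subspace_decomp_exists[of W x] by metis
    have "L \<bullet> x = L \<bullet> p" if "L \<in> W" for L
      using pq(2)[of L] that W by (simp add: pq(3) inner_add_right orthogonal_def inner_commute span_base)
    then show ?thesis using pq(1) W span_eq_iff by blast
  qed
  then obtain proj where proj: "\<And>x. proj x \<in> W" "\<And>x L. L \<in> W \<Longrightarrow> L \<bullet> x = L \<bullet> proj x"
    by metis
  define pt where "pt S = (SOME x. x \<in> S)" for S :: "'a set"
  define y where "y S = sgn (proj (pt S))" for S
  \<comment> \<open>A nonzero functional of \<open>W\<close> eventually does not vanish at the
    chosen point, so the projection of that point is nonzero and \<open>y S\<close> is a unit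
    vector.\<close>
  obtain L0 where L0: "L0 \<in> W" "L0 \<noteq> 0" using W0 W subspace_0 by blast
  have pt: "pt S \<in> S" if "S \<noteq> {}" for S
    using that by (auto simp: pt_def some_in_eq)
  have "eventually (\<lambda>S. y S \<in> W \<inter> sphere 0 1) E"
    using conn miss[rule_format, OF L0]
  proof eventually_elim
    case (elim S)
    then have "L0 \<bullet> pt S \<noteq> 0" using pt by (auto simp: hits_def)
    then have "proj (pt S) \<noteq> 0" using proj(2)[OF L0(1), of "pt S"] by auto
    then show ?case using W proj(1) by (auto simp: y_def sgn_div_norm subspace_scale)
  qed
  moreover have "compact (W \<inter> sphere 0 1)"
    using W by (simp add: closed_Int_compact closed_subspace)
  moreover have "filtermap y E \<noteq> bot" using E by (simp add: filtermap_bot_iff)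
  ultimately obtain v where v: "v \<in> W" "norm v = 1" "inf (nhds v) (filtermap y E) \<noteq> bot"
    unfolding compact_filter by (force simp: eventually_filtermap)
  \<comment> \<open>The coarsest refinement of \<open>E\<close> along which \<open>y\<close> tends
    to \<open>v\<close>; it is proper precisely because \<open>v\<close> is a cluster point.\<close>
  define E' where "E' = inf E (filtercomap y (nhds v))"
  have "E' \<noteq> bot"
  proof
    assume "E' = bot"
    then have "eventually (\<lambda>_. False) E'" by simp
    then obtain P Q where "eventually P E" "eventually Q (filtercomap y (nhds v))" 
        and PQ: "\<And>S. P S \<Longrightarrow> Q S \<Longrightarrow> False"
      unfolding E'_def eventually_inf by blast
    then obtain R where R: "eventually R (nhds v)" "\<And>S. R (y S) \<Longrightarrow> Q S"
      unfolding eventually_filtercomap by blast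
    have "eventually (\<lambda>z. \<not> R z) (filtermap y E)"
      unfolding eventually_filtermap
      by (rule eventually_mono[OF \<open>eventually P E\<close>]) (use PQ R in blast)
    then have "eventually (\<lambda>_. False) (inf (nhds v) (filtermap y E))"
      using R(1) unfolding eventually_inf by blast
    then show False using v(3) by (simp add: trivial_limit_def)
  qed
  moreover have "E' \<le> E" by (simp add: E'_def)
  moreover have "eventually (\<lambda>S. \<forall>x\<in>S. L \<bullet> x > 0) E'" if L: "L \<in> W" "L \<bullet> v > 0" for L
  proof -
    have "eventually (\<lambda>z. L \<bullet> z > 0) (nhds v)"
    proof -
      have "open {z. L \<bullet> z > 0}" by (intro open_Collect_less continuous_intros)
      then show ?thesis using L(2) by (auto simp: eventually_nhds)
    qed
    then have "eventually (\<lambda>S. L \<bullet> y S > 0) (filtercomap y (nhds v))"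
      by (rule eventually_filtercomapI)
    then have "eventually (\<lambda>S. L \<bullet> y S > 0) E'"
      unfolding E'_def by (rule filter_leD[OF inf_le2])
    moreover have "eventually (\<lambda>S. (S \<noteq> {} \<and> connected S) \<and> \<not> hits L S) E'"
    proof (rule filter_leD[OF \<open>E' \<le> E\<close> eventually_conj[OF conn]])
      show "eventually (\<lambda>S. \<not> hits L S) E" using miss L by auto
    qed
    ultimately show ?thesis
    proof eventually_elim
      case (elim S)
      have "L \<bullet> proj (pt S) > 0"
        using elim(1) by (auto simp: y_def sgn_div_norm zero_less_mult_iff zero_less_divide_iff)
      then have "L \<bullet> pt S > 0" using proj(2)[OF L(1)] by simp
      then show ?case using elim pt connected_not_hits_pos by blast
    qed
  qed
  ultimately show thesis using v that by blast
qed

text \<open>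
  Along the filter, \<open>v\<close> dominates every multiple of the functionals orthogonal to it: both
  \<open>v + t *\<^sub>R b\<close> and \<open>v - t *\<^sub>R b\<close> are eventually positive, so \<open>L = c *\<^sub>R v + u\<close> cannot
  vanish once \<open>t\<close> is large compared with \<open>norm u / \<bar>c\<bar>\<close>.
\<close>
lemma eventually_compact_not_hits:
  fixes E :: "'a::euclidean_space set filter"
  assumes W: "subspace W" and v: "v \<in> W" "norm v = 1"
    and pos: "\<And>L. L \<in> W \<Longrightarrow> L \<bullet> v > 0 \<Longrightarrow> eventually (\<lambda>S. \<forall>x\<in>S. L \<bullet> x > 0) E"
    and C: "compact C" "C \<subseteq> W" "\<And>L. L \<in> C \<Longrightarrow> L \<bullet> v \<noteq> 0"
  shows "eventually (\<lambda>S. \<forall>L\<in>C. \<not> hits L S) E"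
proof (cases "C = {}")
  case False
  define W' where "W' = {L \<in> W. L \<bullet> v = 0}"
  have W': "subspace W'"
    using W by (auto simp: W'_def subspace_def inner_add_left)
  obtain B where B: "finite B" "B \<subseteq> W'" "\<And>L. L \<in> W' \<Longrightarrow> (\<Sum>b\<in>B. (L \<bullet> b) *\<^sub>R b) = L"
    "\<And>b. b \<in> B \<Longrightarrow> norm b = 1"
    using obtain_orthonormal_basis[OF W'] by metis
  \<comment> \<open>The minimum of \<open>\<bar>L \<bullet> v\<bar>\<close> over the nonempty
    compact set \<open>C\<close> is attained, hence positive.\<close>
  obtain e where e: "e > 0" "\<And>L. L \<in> C \<Longrightarrow> \<bar>L \<bullet> v\<bar> \<ge> e"
  proof -
    have "continuous_on C (\<lambda>L. \<bar>L \<bullet> v\<bar>)" by (intro continuous_intros)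
    then obtain L1 where "L1 \<in> C" "\<And>L. L \<in> C \<Longrightarrow> \<bar>L1 \<bullet> v\<bar> \<le> \<bar>L \<bullet> v\<bar>"
      using continuous_attains_inf[OF C(1) False] by metis
    then show ?thesis using that[of "\<bar>L1 \<bullet> v\<bar>"] C(3) by simp
  qed
  obtain M where M: "M > 0" "\<And>L. L \<in> C \<Longrightarrow> norm L \<le> M"
    using compact_imp_bounded[OF C(1)] bounded_pos by metis
  \<comment> \<open>Chosen so that \<open>card B\<close> terms of size
    \<open>M * ((v \<bullet> x) / t)\<close> add up to less than \<open>e * (v \<bullet> x)\<close>;
    the summand 1 makes this strict and keeps \<open>t\<close> positive when \<open>B\<close> is
    empty.\<close>
  define t where "t = M / e * (card B + 1)"
  have "t > 0" using M(1) e(1) by (simp add: t_def)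
  have ball: "eventually (\<lambda>S. \<forall>b\<in>B. (\<forall>x\<in>S. (v + t *\<^sub>R b) \<bullet> x > 0) \<and> (\<forall>x\<in>S. (v - t *\<^sub>R b) \<bullet> x > 0)) E"
  proof (intro eventually_ball_finite[OF B(1)] ballI eventually_conj pos)
    fix b assume "b \<in> B"
    then have b: "b \<in> W" "b \<bullet> v = 0" using B(2) by (auto simp: W'_def)
    show "v + t *\<^sub>R b \<in> W" "v - t *\<^sub>R b \<in> W"
      using W v b by (auto intro: subspace_add subspace_diff subspace_scale)
    have "v \<bullet> v = 1" using v(2) by (simp add: norm_eq_1)
    then show "(v + t *\<^sub>R b) \<bullet> v > 0" "(v - t *\<^sub>R b) \<bullet> v > 0"
      using b by (simp_all add: inner_add_left inner_diff_left)
  qed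
  have vpos: "eventually (\<lambda>S. \<forall>x\<in>S. v \<bullet> x > 0) E"
    by (rule pos[OF v(1)]) (use v(2) in \<open>simp add: norm_eq_1\<close>)
  show ?thesis
    using ball vpos
  proof eventually_elim
    case (elim S)
    show ?case
    proof (intro ballI notI)
      fix L assume L: "L \<in> C" and "hits L S"
      then obtain x where x: "x \<in> S" "L \<bullet> x = 0" by (auto simp: hits_def)
      \<comment> \<open>The part of \<open>L\<close> orthogonal to \<open>v\<close>. A zero
        \<open>x\<close> of \<open>L\<close> forces \<open>\<bar>u \<bullet> x\<bar> = \<bar>L
        \<bullet> v\<bar> * (v \<bullet> x)\<close>, which is too large for the bound obtained from
        the basis \<open>B\<close>.\<close>
      define u where "u = L - (L \<bullet> v) *\<^sub>R v"
      have "v \<bullet> v = 1" using v(2) by (simp add: norm_eq_1)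
      then have u: "u \<in> W'"
        using L C(2) W v(1)
        by (auto simp: u_def W'_def inner_diff_left intro!: subspace_diff subspace_scale)
      have vx: "v \<bullet> x > 0" using elim x by blast
      have b: "\<bar>(u \<bullet> b) * (b \<bullet> x)\<bar> \<le> M * ((v \<bullet> x) / t)" if "b \<in> B" for b
      proof -
        have "b \<bullet> v = 0" using that B(2) by (auto simp: W'_def)
        then have "u \<bullet> b = L \<bullet> b" by (simp add: u_def inner_diff_left inner_commute[of v])
        moreover have "\<bar>L \<bullet> b\<bar> \<le> M"
          using Cauchy_Schwarz_ineq2[of L b] B(4)[OF that] M(2)[OF L] by simp
        moreover have "\<bar>b \<bullet> x\<bar> \<le> (v \<bullet> x) / t"
        proof -
          have "v \<bullet> x + t * (b \<bullet> x) > 0" "v \<bullet> x - t * (b \<bullet> x) > 0"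
            using elim(1) that x(1) by (auto simp: inner_add_left inner_diff_left)
          then have "t * \<bar>b \<bullet> x\<bar> \<le> v \<bullet> x" by (auto simp: abs_if)
          then show ?thesis using \<open>t > 0\<close> by (simp add: field_simps)
        qed
        ultimately show ?thesis using M(1) by (simp only: abs_mult) (intro mult_mono; simp)
      qed
      have "u \<bullet> x = (\<Sum>b\<in>B. (u \<bullet> b) * (b \<bullet> x))"
        using arg_cong[OF B(3)[OF u], of "\<lambda>z. z \<bullet> x"] by (simp add: inner_sum_left)
      then have "\<bar>u \<bullet> x\<bar> \<le> (\<Sum>b\<in>B. M * ((v \<bullet> x) / t))"
        using b by (auto intro!: order_trans[OF sum_abs] sum_mono simp del: sum_constant)
      also have "\<dots> = e * (v \<bullet> x) * (card B / (card B + 1))"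
        using M(1) e(1) by (simp add: t_def)
      also have "\<dots> < e * (v \<bullet> x) * 1"
        using e(1) vx by (intro mult_strict_left_mono) (auto simp: divide_simps)
      also have "\<dots> \<le> \<bar>L \<bullet> v\<bar> * (v \<bullet> x)"
        using e(2)[OF L] vx by simp
      also have "\<dots> = \<bar>u \<bullet> x\<bar>"
        using x(2) vx by (simp add: u_def inner_diff_left abs_mult)
      finally show False by simp
    qed
  qed
qed simp

section \<open>The flag of subspaces of functionals\<close>

text \<open>Induction on the dimension: split off a direction \<open>v\<close> and apply the
  induction hypothesis to its orthogonal complement \<open>W'\<close> in \<open>W\<close>. The flag
  of \<open>W'\<close> is then topped by \<open>W\<close>, and the new layer \<open>W - W'\<close>
  consists of the functionals of \<open>W\<close> that are nonzero at \<open>v\<close>.\<close>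

lemma flag_exists:
  fixes E :: "'a::euclidean_space set filter"
  assumes "E \<noteq> bot" "subspace W" "dim W = k"
    and "eventually (\<lambda>S. S \<noteq> {} \<and> connected S) E"
    and "\<forall>L\<in>W. L \<noteq> 0 \<longrightarrow> eventually (\<lambda>S. \<not> hits L S) E"
  shows "\<exists>E' V. E' \<le> E \<and> E' \<noteq> bot \<and> V 0 = {0} \<and> V k = W \<and> (\<forall>i\<le>k. subspace (V i)) \<and>
    (\<forall>i<k. \<forall>C. compact C \<longrightarrow> C \<subseteq> V (Suc i) - V i \<longrightarrow>
       eventually (\<lambda>S. \<forall>L\<in>C. \<not> hits L S) E')"
  using assms
proof (induction k arbitrary: E W)
  case 0
  then have "W = {0}"
    using dim_eq_0 subspace_0 by blast
  then show ?case using 0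
    by (intro exI[of _ E] exI[of _ "\<lambda>_. {0}"]) auto
next
  case (Suc k)
  have "W \<noteq> {0}" using Suc.prems(3) by auto
  obtain E1 v where E1: "E1 \<le> E" "E1 \<noteq> bot" and v: "v \<in> W" "norm v = 1"
    and pos: "\<forall>L\<in>W. L \<bullet> v > 0 \<longrightarrow> eventually (\<lambda>S. \<forall>x\<in>S. L \<bullet> x > 0) E1"
    by (rule cluster_direction[OF Suc.prems(1,2) \<open>W \<noteq> {0}\<close> Suc.prems(4,5)]) (rule that)
  define W' where "W' = {L \<in> W. L \<bullet> v = 0}"
  have W': "subspace W'"
    using Suc.prems(2) by (auto simp: W'_def subspace_def inner_add_left)
  have "W' = {y \<in> W. \<forall>x \<in> span {v}. orthogonal x y}"
    by (auto simp: W'_def span_singleton orthogonal_def inner_commute)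
  moreover have "span {v} \<subseteq> W" using v(1) Suc.prems(2) by (simp add: span_minimal)
  moreover have "dim (span {v}) = 1" using v(2) by (auto simp: dim_span dim_insert)
  ultimately have dim: "dim W' = k"
    using dim_subspace_orthogonal_to_vectors[of "span {v}" W] Suc.prems(2,3) by simp
  have conn: "eventually (\<lambda>S. S \<noteq> {} \<and> connected S) E1"
    by (rule filter_leD[OF E1(1) Suc.prems(4)])
  have miss: "\<forall>L\<in>W'. L \<noteq> 0 \<longrightarrow> eventually (\<lambda>S. \<not> hits L S) E1"
    using Suc.prems(5) filter_leD[OF E1(1)] by (auto simp: W'_def)
  obtain E' V where IH: "E' \<le> E1" "E' \<noteq> bot" "V 0 = {0}" "V k = W'"
    "\<forall>i\<le>k. subspace (V i)"
    "\<forall>i<k. \<forall>C. compact C \<longrightarrow> C \<subseteq> V (Suc i) - V i \<longrightarrow>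
       eventually (\<lambda>S. \<forall>L\<in>C. \<not> hits L S) E'"
    using Suc.IH[OF E1(2) W' dim conn miss] by (elim exE conjE)
  \<comment> \<open>Positivity was obtained along \<open>E1\<close> and persists along the finer
    \<open>E'\<close> that the induction hypothesis returns.\<close>
  have last: "eventually (\<lambda>S. \<forall>L\<in>C. \<not> hits L S) E'" if "compact C" "C \<subseteq> W - W'" for C
  proof (rule eventually_compact_not_hits[OF Suc.prems(2) v _ that(1)])
    show "eventually (\<lambda>S. \<forall>x\<in>S. L \<bullet> x > 0) E'" if "L \<in> W" "L \<bullet> v > 0" for L
      by (rule filter_leD[OF IH(1) pos[rule_format, OF that]])
  qed (use that(2) in \<open>auto simp: W'_def\<close>)
  show ?case
  proof (intro exI[of _ E'] exI[of _ "V(Suc k := W)"] conjI allI impI)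
    show "E' \<le> E" using IH(1) E1(1) by order
    show "subspace ((V(Suc k := W)) i)" if "i \<le> Suc k" for i
      using that IH(5) Suc.prems(2) by (auto simp: le_Suc_eq)
    show "eventually (\<lambda>S. \<forall>L\<in>C. \<not> hits L S) E'"
      if "i < Suc k" "compact C" "C \<subseteq> (V(Suc k := W)) (Suc i) - (V(Suc k := W)) i" for i C
      using that IH(4) IH(6)[rule_format, of i C] last by (cases "i = k") auto
  qed (use IH in auto)
qed

section \<open>Selecting members in general position\<close>

text \<open>The unit functionals of \<open>W\<close> with a zero on every member of \<open>J\<close>
  form a compact set that avoids \<open>W'\<close>, so eventually none of them has a zero on
  \<open>S\<close>. Rescaling extends this to all nonzero functionals of \<open>W\<close>.\<close>

lemma eventually_insert_not_all_hit:
  fixes E :: "'a::euclidean_space set filter"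
  assumes W: "subspace W" and J: "\<And>S. S \<in> J \<Longrightarrow> compact S"
    and W': "\<And>L. L \<in> W' \<Longrightarrow> L \<noteq> 0 \<Longrightarrow> \<exists>S\<in>J. \<not> hits L S"
    and E: "\<And>C. compact C \<Longrightarrow> C \<subseteq> W - W' \<Longrightarrow> eventually (\<lambda>S. \<forall>L\<in>C. \<not> hits L S) E"
  shows "eventually (\<lambda>S. \<forall>L\<in>W. L \<noteq> 0 \<longrightarrow> (\<exists>S'\<in>insert S J. \<not> hits L S')) E"
proof -
  define C where "C = (W \<inter> (\<Inter>S\<in>J. {L. hits L S})) \<inter> sphere 0 1"
  have "compact C"
    unfolding C_def using W J closed_hits
    by (intro closed_Int_compact closed_Int closed_INT closed_subspace) auto
  moreover have "C \<subseteq> W - W'"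
    using W' by (fastforce simp: C_def)
  ultimately have "eventually (\<lambda>S. \<forall>L\<in>C. \<not> hits L S) E" by (rule E)
  then show ?thesis
  proof eventually_elim
    case (elim S)
    show ?case
    proof (intro ballI impI)
      fix L assume L: "L \<in> W" "L \<noteq> 0"
      show "\<exists>S'\<in>insert S J. \<not> hits L S'"
      proof (rule ccontr)
        assume "\<not> (\<exists>S'\<in>insert S J. \<not> hits L S')"
        then have "sgn L \<in> C" "hits (sgn L) S"
          using L W by (auto simp: C_def sgn_div_norm hits_scaleR_iff subspace_scale)
        then show False using elim by blast
      qed
    qed
  qed
qed

theorem finite_hitting_set:
  fixes F :: "'a::euclidean_space set set"
  assumes dim: "DIM('a) \<ge> 2"
    and F: "\<And>S. S \<in> F \<Longrightarrow> S \<noteq> {} \<and> compact S \<and> connected S"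
    and inf: "\<And>G. G \<subseteq> F \<Longrightarrow> infinite G \<Longrightarrow>
      \<exists>T\<subseteq>G. card T = DIM('a) \<and> (\<exists>L. L \<noteq> 0 \<and> (\<forall>S\<in>T. hits L S))"
  shows "\<exists>X. finite X \<and> 0 \<notin> X \<and> (\<forall>S\<in>F. \<exists>L\<in>X. hits L S)"
proof (rule ccontr)
  assume contr: "\<nexists>X. finite X \<and> 0 \<notin> X \<and> (\<forall>S\<in>F. \<exists>L\<in>X. hits L S)"
  define n where "n = DIM('a)"
  \<comment> \<open>Generated by the sets of members that a given nonzero \<open>L\<close> misses.
    Finitely many of these have a common element, since otherwise a finite \<open>X\<close> would
    hit all of \<open>F\<close>; hence the filter is proper.\<close>
  define E0 where "E0 = (INF L\<in>-{0}. principal {S\<in>F. \<not> hits L S})"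
  have E0: "E0 \<noteq> bot"
    unfolding E0_def
  proof (rule INF_filter_not_bot)
    fix X :: "'a set" assume X: "X \<subseteq> - {0}" "finite X"
    then have "\<not> (\<forall>S\<in>F. \<exists>L\<in>X. hits L S)" using contr by auto
    then have "(\<Inter>L\<in>X. {S\<in>F. \<not> hits L S}) \<noteq> {}" by blast
    then show "(INF L\<in>X. principal {S\<in>F. \<not> hits L S}) \<noteq> bot"
      by (simp add: INF_principal_finite[OF X(2)] principal_eq_bot_iff)
  qed
  have ev0: "eventually (\<lambda>S. S \<in> F \<and> \<not> hits L S) E0" if "L \<noteq> 0" for L
  proof -
    have "E0 \<le> principal {S\<in>F. \<not> hits L S}"
      unfolding E0_def by (rule INF_lower) (use that in simp)
    then show ?thesis by (simp add: le_principal)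
  qed
  obtain b :: 'a where "b \<noteq> 0" using nonzero_Basis SOME_Basis by blast
  have ev0F: "eventually (\<lambda>S. S \<in> F) E0"
    using ev0[OF \<open>b \<noteq> 0\<close>] by (rule eventually_mono) simp
  have "eventually (\<lambda>S. S \<noteq> {} \<and> connected S) E0"
    using ev0F by (rule eventually_mono) (use F in blast)
  moreover have "\<forall>L\<in>UNIV. L \<noteq> 0 \<longrightarrow> eventually (\<lambda>S. \<not> hits L S) E0"
    using ev0 eventually_mono by fast
  ultimately obtain E V where EV: "E \<le> E0" "E \<noteq> bot" "V 0 = {0}" "V n = UNIV"
    "\<And>i. i \<le> n \<Longrightarrow> subspace (V i)"
    "\<And>i C. i < n \<Longrightarrow> compact C \<Longrightarrow> C \<subseteq> V (Suc i) - V i \<Longrightarrow>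
       eventually (\<lambda>S. \<forall>L\<in>C. \<not> hits L S) E"
    using flag_exists[OF E0 subspace_UNIV, of n] unfolding n_def by (auto simp: dim_UNIV)
  \<comment> \<open>The number of sets equals the index in the flag, so that adding a set moves up
    exactly one layer; at \<open>n\<close> the subspace is the whole space.\<close>
  define good where "good A \<longleftrightarrow>
    (\<forall>J\<subseteq>A. card J \<le> n \<longrightarrow> (\<forall>L\<in>V (card J). L \<noteq> 0 \<longrightarrow> (\<exists>S\<in>J. \<not> hits L S)))" for A
  \<comment> \<open>In dimension at least 2 some nonzero functional vanishes at a point of
    \<open>S0\<close>. Members near the end of the filter miss this functional and so differ from
    \<open>S0\<close>.\<close>
  have new: "eventually (\<lambda>S. S \<noteq> S0) E0" if S0: "S0 \<in> F" for S0
  proof -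
    obtain x where "x \<in> S0" using F[OF S0] by blast
    moreover obtain L where "L \<noteq> 0" "orthogonal x L"
      using orthogonal_to_vector_exists[OF dim, of x] by metis
    ultimately have "hits L S0" by (auto simp: hits_def orthogonal_def inner_commute)
    then show ?thesis
      using ev0[OF \<open>L \<noteq> 0\<close>] by (auto elim!: eventually_mono)
  qed
  have step: "\<exists>S. S \<in> F - A \<and> good (insert S A)"
    if A: "finite A" "A \<subseteq> F" "good A" for A
  proof -
    have "eventually (\<lambda>S. \<forall>S0\<in>A. S \<noteq> S0) E"
      by (rule filter_leD[OF EV(1)], rule eventually_ball_finite[OF A(1)]) (use new A(2) in blast)
    moreover have "eventually (\<lambda>S. S \<in> F) E"
      by (rule filter_leD[OF EV(1) ev0F])
    \<comment> \<open>Goodness of \<open>A\<close> excludes common functionals of \<open>J\<close>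
      in \<open>V (card J)\<close>; only the layer up to \<open>V (Suc (card J))\<close> is left for
      the new set to avoid. There are finitely many such \<open>J\<close>.\<close>
    moreover have "eventually (\<lambda>S. \<forall>J\<in>{J. J \<subseteq> A \<and> card J < n}.
        \<forall>L\<in>V (Suc (card J)). L \<noteq> 0 \<longrightarrow> (\<exists>S'\<in>insert S J. \<not> hits L S')) E"
    proof (rule eventually_ball_finite[OF _ ballI])
      fix J assume J: "J \<in> {J. J \<subseteq> A \<and> card J < n}"
      show "eventually (\<lambda>S. \<forall>L\<in>V (Suc (card J)). L \<noteq> 0 \<longrightarrow> (\<exists>S'\<in>insert S J. \<not> hits L S')) E"
      proof (rule eventually_insert_not_all_hit[where W' = "V (card J)"])
        show "\<exists>S\<in>J. \<not> hits L S" if "L \<in> V (card J)" "L \<noteq> 0" for L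
          using A(3) J that unfolding good_def by auto
      qed (use J A(2) F EV in auto)
    qed (use A(1) in simp)
    ultimately have "eventually (\<lambda>S. S \<in> F - A \<and> good (insert S A)) E"
    proof eventually_elim
      case (elim S)
      have "\<exists>S'\<in>J. \<not> hits L S'"
        if J: "J \<subseteq> insert S A" "card J \<le> n" and L: "L \<in> V (card J)" "L \<noteq> 0" for J L
      proof (cases "S \<in> J")
        case False
        then show ?thesis using A(3) J L unfolding good_def by (metis subset_insert)
      next
        case True
        define J' where "J' = J - {S}"
        have "finite J" using J(1) A(1) by (simp add: finite_subset)
        then have "card J = Suc (card J')"
          unfolding J'_def by (rule card.remove[OF _ True])
        moreover have "insert S J' = J" using True by (auto simp: J'_def)
        moreover have "J' \<subseteq> A" using J(1) by (auto simp: J'_def)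
        ultimately show ?thesis using elim(3) J(2) L by (auto simp: Suc_le_eq)
      qed
      then show ?case using elim(1,2) by (auto simp: good_def)
    qed
    then show ?thesis using EV(2) eventually_happens' by blast
  qed
  have "\<exists>A. \<forall>m. (finite (A m) \<and> card (A m) = m \<and> A m \<subseteq> F \<and> good (A m)) \<and> A m \<subseteq> A (Suc m)"
  proof (rule dependent_nat_choice)
    \<comment> \<open>The empty collection is good because \<open>V 0\<close> contains no nonzero
      functional.\<close>
    show "\<exists>A. finite A \<and> card A = 0 \<and> A \<subseteq> F \<and> good A"
      by (rule exI[of _ "{}"]) (simp add: good_def EV(3))
    fix A m assume A: "finite A \<and> card A = m \<and> A \<subseteq> F \<and> good A"
    then obtain S where "S \<in> F - A" "good (insert S A)" using step by blast
    with A show "\<exists>A'. (finite A' \<and> card A' = Suc m \<and> A' \<subseteq> F \<and> good A') \<and> A \<subseteq> A'"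
      by (intro exI[of _ "insert S A"]) auto
  qed
  then obtain A where A: "\<And>m. finite (A m)" "\<And>m. card (A m) = m" "\<And>m. A m \<subseteq> F"
    "\<And>m. good (A m)" and "\<And>m. A m \<subseteq> A (Suc m)" by metis
  then have mono: "mono A" by (simp add: mono_iff_le_Suc)
  have "infinite (\<Union>m. A m)"
  proof
    assume fin: "finite (\<Union>m. A m)"
    have "card (A (Suc (card (\<Union>m. A m)))) \<le> card (\<Union>m. A m)"
      by (rule card_mono[OF fin]) blast
    then show False by (simp add: A(2))
  qed
  moreover have "(\<Union>m. A m) \<subseteq> F" using A(3) by blast
  ultimately obtain T L where T: "T \<subseteq> (\<Union>m. A m)" "card T = n" and L: "L \<noteq> 0" "\<forall>S\<in>T. hits L S"
    using inf unfolding n_def by meson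
  have "finite T" using T(2) card_ge_0_finite[of T] by (simp add: n_def)
  obtain f where f: "\<And>S. S \<in> T \<Longrightarrow> S \<in> A (f S)" using T(1) by (metis UN_iff subsetD)
  \<comment> \<open>The finite set \<open>T\<close> already lies in one stage of the increasing
    chain, whose goodness rules out the common functional \<open>L\<close>.\<close>
  define m where "m = Max (f ` T)"
  have "A (f S) \<subseteq> A m" if "S \<in> T" for S
    using that \<open>finite T\<close> mono by (simp add: m_def monoD)
  then have "T \<subseteq> A m" using f by blast
  moreover have "L \<in> V (card T)" using T(2) EV(4) by simp
  ultimately have "\<exists>S\<in>T. \<not> hits L S"
    using A(4)[of m] T(2) L(1) unfolding good_def by simp
  then show False using L(2) by blast
qed

section \<open>From linear functionals back to hyperplanes\<close>

text \<open>On the copy of \<open>S\<close> at height 1 the functional \<open>(c, a)\<close> acts as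
  the affine function with linear part \<open>a\<close> and constant term \<open>c\<close>.\<close>

lemma hits_Pair_image:
  "hits (c, a) (Pair 1 ` S) \<longleftrightarrow> (\<exists>x\<in>S. a \<bullet> x = - c)" for c :: real
  by (auto simp: hits_def inner_prod_def add_eq_0_iff)

lemma affine_hyperplane_iff:
  fixes H :: "(real ^ 'd) set"
  shows "affine_hyperplane H \<longleftrightarrow> (\<exists>a b. a \<noteq> 0 \<and> H = {x. a \<bullet> x = b})"
proof
  assume "affine_hyperplane H"
  then have "affine hull H = H" "aff_dim H = DIM(real ^ 'd) - 1"
    by (simp_all add: affine_hyperplane_def)
  then show "\<exists>a b. a \<noteq> 0 \<and> H = {x. a \<bullet> x = b}" by (metis aff_dim_eq_hyperplane)
next
  assume "\<exists>a b. a \<noteq> 0 \<and> H = {x. a \<bullet> x = b}"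
  then show "affine_hyperplane H"
    by (auto simp: affine_hyperplane_def affine_hyperplane)
qed

theorem theorem2:
  fixes F :: "(real ^ 'd) set set"
  assumes "\<And>S. S \<in> F \<Longrightarrow> S \<noteq> {} \<and> compact S \<and> connected S"
    and "\<And>G. G \<subseteq> F \<Longrightarrow> infinite G \<Longrightarrow>
           \<exists>T \<subseteq> G. card T = CARD('d) + 1 \<and>
             (\<exists>H. affine_hyperplane H \<and> (\<forall>S\<in>T. pierces H S))"
  shows "finite_hyperplane_transversal F"
proof -
  define lift :: "(real ^ 'd) set \<Rightarrow> (real \<times> (real ^ 'd)) set" where "lift S = Pair 1 ` S" for S
  \<comment> \<open>Injectivity keeps the \<open>CARD('d) + 1\<close> sets distinct after lifting;
    their number is the dimension of the product space.\<close>
  have inj: "inj lift" unfolding lift_def by (auto intro: injI)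
  have "\<exists>X. finite X \<and> 0 \<notin> X \<and> (\<forall>S\<in>lift ` F. \<exists>L\<in>X. hits L S)"
  proof (rule finite_hitting_set)
    show "S \<noteq> {} \<and> compact S \<and> connected S" if "S \<in> lift ` F" for S
      using that assms(1) unfolding lift_def
      by (auto intro!: compact_continuous_image connected_continuous_image continuous_intros)
  next
    fix G assume G: "G \<subseteq> lift ` F" "infinite G"
    then obtain G' where G': "G' \<subseteq> F" "G = lift ` G'" by (meson subset_imageE)
    then obtain T H where T: "T \<subseteq> G'" "card T = CARD('d) + 1"
      and H: "affine_hyperplane H" "\<forall>S\<in>T. pierces H S"
      using assms(2)[of G'] G(2) by auto
    obtain a b where ab: "a \<noteq> 0" "H = {x. a \<bullet> x = b}" using H(1) affine_hyperplane_iff by metis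
    show "\<exists>T\<subseteq>G. card T = DIM(real \<times> (real ^ 'd)) \<and> (\<exists>L. L \<noteq> 0 \<and> (\<forall>S\<in>T. hits L S))"
    proof (intro exI[of _ "lift ` T"] exI[of _ "(-b, a)"] conjI)
      show "card (lift ` T) = DIM(real \<times> (real ^ 'd))"
        using T(2) inj by (simp add: card_image inj_on_subset)
      show "\<forall>S\<in>lift ` T. hits (-b, a) S"
        using H(2) ab(2) by (auto simp: lift_def hits_Pair_image pierces_def)
    qed (use T(1) G' ab(1) in \<open>auto simp: zero_prod_def\<close>)
  qed (simp add: Suc_le_eq)
  then obtain X where X: "finite X" "0 \<notin> X" "\<And>S. S \<in> F \<Longrightarrow> \<exists>L\<in>X. hits L (lift S)" by blast
  \<comment> \<open>Functionals with \<open>a = 0\<close> define no hyperplane. Dropping them is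
    harmless: such a functional is a nonzero constant at height 1 and hits no lifted set.\<close>
  define \<H> where "\<H> = (\<lambda>(c, a). {x. a \<bullet> x = - c}) ` {L \<in> X. snd L \<noteq> 0}"
  have "finite \<H>" using X(1) by (simp add: \<H>_def)
  moreover have "affine_hyperplane H" if "H \<in> \<H>" for H
    using that by (force simp: \<H>_def affine_hyperplane_iff)
  moreover have "\<exists>H\<in>\<H>. pierces H S" if S: "S \<in> F" for S
  proof -
    obtain c a where L: "(c, a) \<in> X" "hits (c, a) (lift S)" using X(3)[OF S] by auto
    then obtain x where "x \<in> S" "a \<bullet> x = - c" by (auto simp: lift_def hits_Pair_image)
    moreover from this have "a \<noteq> 0" using L(1) X(2) by (auto simp: zero_prod_def)
    ultimately show ?thesis using L(1) by (force simp: \<H>_def pierces_def)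
  qed
  ultimately show ?thesis unfolding finite_hyperplane_transversal_def by blast
qed

end
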